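(* Every finite simple undirected graph $G=(V,E)$ has an MLS cover; that is, every vertex $u\in V$ is contained in at least one minimal local set of $G$.
   Context: For a finite simple undirected graph $G=(V,E)$ and $D\subseteq V$, the odd neighborhood of $D$ is $Odd_G(D)=\{v\in V : |N_G(v)\cap D| \equiv 1 \pmod 2\}$, where $N_G(v)$ is the set of neighbors of $v$. A local set of $G$ is a non-empty subset $L\subseteq V$ of the form $L=D\cup Odd_G(D)$ for some $D\subseteq V$. A minimal local set is a local set that is minimal by inclusion among local sets. A family $\mathcal L\subseteq 2^V$ is an MLS cover of $G$ if every $L\in\mathcal L$ is a minimal local set of $G$ and every $u\in V$ belongs to some $L\in\mathcal L$. *)

theory Defs
  imports "Graph_Theory.Digraph"
begin

text \<open>
  A finite simple undirected graph is an element of the locale \<^locale>\<open>graph\<close>: a finite digraph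
  without loops or parallel arcs whose arc relation is symmetric. An undirected edge between
  \<open>u\<close> and \<open>v\<close> is represented by the two arcs \<open>u \<rightarrow>\<^bsub>G\<^esub> v\<close> and \<open>v \<rightarrow>\<^bsub>G\<^esub> u\<close>.
\<close>

definition nbhd :: "('a, 'b) pre_digraph \<Rightarrow> 'a \<Rightarrow> 'a set" where
  "nbhd G v = {w \<in> verts G. v \<rightarrow>\<^bsub>G\<^esub> w}"

definition odd_nbhd :: "('a, 'b) pre_digraph \<Rightarrow> 'a set \<Rightarrow> 'a set" where
  "odd_nbhd G D = {v \<in> verts G. odd (card (nbhd G v \<inter> D))}"

definition local_set :: "('a, 'b) pre_digraph \<Rightarrow> 'a set \<Rightarrow> bool" where
  "local_set G L \<longleftrightarrow> L \<noteq> {} \<and> (\<exists>D. D \<subseteq> verts G \<and> L = D \<union> odd_nbhd G D)"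

definition minimal_local_set :: "('a, 'b) pre_digraph \<Rightarrow> 'a set \<Rightarrow> bool" where
  "minimal_local_set G L \<longleftrightarrow>
     local_set G L \<and> (\<forall>L'. local_set G L' \<and> L' \<subseteq> L \<longrightarrow> L' = L)"

definition mls_cover :: "('a, 'b) pre_digraph \<Rightarrow> 'a set set \<Rightarrow> bool" where
  "mls_cover G \<L> \<longleftrightarrow>
     \<L> \<subseteq> Pow (verts G) \<and> (\<forall>L \<in> \<L>. minimal_local_set G L) \<and> (\<forall>u \<in> verts G. \<exists>L \<in> \<L>. u \<in> L)"

end

(* Encode D by the vector of (F_2 x F_2)^V with entries ([v \<in> D], [v \<in> Odd D]). These vectors form a
   self-orthogonal space for the symplectic form, and local sets are the supports of the non-zero
   ones. If no minimal local set contains u, choose A maximal among the sets avoiding u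
   that contain no local set. Then A + u contains none either, so by duality every pattern on A + u
   is realised; in particular there are vectors C, D vanishing on A and non-orthogonal at u.
   Every other v outside A is the only vertex outside A of the support of some vector,
   which forces C and D to be orthogonal at v. So the total form of C and D is 1, a contradiction. *)
theory Submission
  imports Defs
begin

lemma odd_card_sym_diff:
  assumes "finite A" "finite B"
  shows "odd (card (sym_diff A B)) \<longleftrightarrow> odd (card A) \<noteq> odd (card B)"
proof -
  have "card A = card (A - B) + card (A \<inter> B)" "card B = card (B - A) + card (A \<inter> B)"
    using assms card_Int_Diff[of A B] card_Int_Diff[of B A] by (auto simp: Int_commute)
  moreover have "card (sym_diff A B) = card (A - B) + card (B - A)"
    using assms by (intro card_Un_disjoint) auto
  ultimately show ?thesis
    by presburger
qed

text \<open>Linear duality over F_2: the traces of \<open>W\<close> on \<open>A\<close> form a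
  subspace of the power set of \<open>A\<close>, and a proper subspace would be annihilated by a
  non-zero functional, that is, by the parity of the intersection with some non-empty
  \<open>D\<close>. The hypothesis on parities excludes this.\<close>

lemma sym_diff_closed_realises_subsets:
  assumes "finite A"
    and empty: "{} \<in> W"
    and closed: "\<And>w w'. w \<in> W \<Longrightarrow> w' \<in> W \<Longrightarrow> sym_diff w w' \<in> W"
    and odd: "\<And>D. D \<subseteq> A \<Longrightarrow> D \<noteq> {} \<Longrightarrow> \<exists>w\<in>W. odd (card (w \<inter> D))"
    and "T \<subseteq> A"
  shows "\<exists>w\<in>W. w \<inter> A = T"
  using assms(1) odd \<open>T \<subseteq> A\<close>
proof (induction A arbitrary: T rule: finite_induct)
  case empty
  then show ?case using \<open>{} \<in> W\<close> by auto
next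
  case (insert a A)
  have IH: "\<exists>w\<in>W. w \<inter> A = T" if "T \<subseteq> A" for T
  proof (rule insert.IH)
    show "\<exists>w\<in>W. odd (card (w \<inter> D))" if "D \<subseteq> A" "D \<noteq> {}" for D
      using that by (intro insert.prems(1)) auto
  qed fact
  \<comment> \<open>Such a \<open>k\<close> suffices: adding it corrects the membership of
    \<open>a\<close> in a set supplied by \<open>IH\<close> without changing the trace on
    \<open>A\<close>.\<close>
  have "\<exists>k\<in>W. k \<inter> insert a A = {a}"
  proof (rule ccontr)
    assume none: "\<not> ?thesis"
    have det: "a \<in> w \<longleftrightarrow> a \<in> w'" if "w \<in> W" "w' \<in> W" "w \<inter> A = w' \<inter> A" for w w'
    proof (rule ccontr)
      assume "\<not> ?thesis"
      then have "sym_diff w w' \<inter> insert a A = {a}"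
        using that(3) \<open>a \<notin> A\<close> by blast
      then show False using none closed that by blast
    qed
    \<comment> \<open>By \<open>det\<close>, membership of \<open>a\<close> is a linear functional
      of the trace on \<open>A\<close>. \<open>D\<close> collects the singletons on which it takes
      the value 1, so the functional is the parity of the intersection with
      \<open>D\<close>.\<close>
    define D where "D = {b \<in> A. \<exists>w\<in>W. w \<inter> A = {b} \<and> a \<in> w}"
    have "D \<subseteq> A" by (auto simp: D_def)
    then have finD: "finite D" and "a \<notin> D" using insert.hyps by (auto intro: finite_subset)
    have phi: "a \<in> w \<longleftrightarrow> odd (card (w \<inter> D))" if "w \<in> W" for w
    proof -
      have "\<forall>w\<in>W. w \<inter> A = T \<longrightarrow> (a \<in> w \<longleftrightarrow> odd (card (w \<inter> D)))" if "T \<subseteq> A" "finite T" for T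
        using that(2,1)
      proof (induction T rule: finite_induct)
        case empty
        show ?case
        proof (intro ballI impI)
          fix w assume "w \<in> W" "w \<inter> A = {}"
          moreover from this have "w \<inter> D = {}" using \<open>D \<subseteq> A\<close> by blast
          ultimately show "a \<in> w \<longleftrightarrow> odd (card (w \<inter> D))"
            using det[of w "{}"] \<open>{} \<in> W\<close> by simp
        qed
      next
        case (insert b T)
        show ?case
        proof (intro ballI impI)
          fix w assume w: "w \<in> W" "w \<inter> A = insert b T"
          obtain x where x: "x \<in> W" "x \<inter> A = {b}" using IH[of "{b}"] insert.prems by auto
          have b: "b \<in> D \<longleftrightarrow> a \<in> x"
          proof
            assume "b \<in> D"
            then obtain y where "y \<in> W" "y \<inter> A = {b}" "a \<in> y" by (auto simp: D_def)
            then show "a \<in> x" using det[of y x] x by simp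
          next
            assume "a \<in> x"
            then show "b \<in> D" using x by (auto simp: D_def)
          qed
          have xD: "x \<inter> D = {b} \<inter> D" using x \<open>D \<subseteq> A\<close> by blast
          have "sym_diff w x \<inter> A = sym_diff (w \<inter> A) (x \<inter> A)" by blast
          also have "\<dots> = T" using w x insert.hyps by simp
          finally have "a \<in> sym_diff w x \<longleftrightarrow> odd (card (sym_diff w x \<inter> D))"
            using bspec[OF insert.IH closed[OF w(1) x(1)]] insert.prems by blast
          moreover have "sym_diff w x \<inter> D = sym_diff (w \<inter> D) (x \<inter> D)" by blast
          moreover have "odd (card (x \<inter> D)) \<longleftrightarrow> a \<in> x" using b xD by (cases "b \<in> D") auto
          ultimately show "a \<in> w \<longleftrightarrow> odd (card (w \<inter> D))"
            using finD odd_card_sym_diff[of "w \<inter> D" "x \<inter> D"] by auto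
        qed
      qed
      from this[of "w \<inter> A"] show ?thesis using insert.hyps that by simp
    qed
    \<comment> \<open>By \<open>phi\<close>, every member of \<open>W\<close> meets
      \<open>insert a D\<close> in an even number of elements.\<close>
    obtain w where w: "w \<in> W" "odd (card (w \<inter> insert a D))"
      using insert.prems(1)[of "insert a D"] \<open>D \<subseteq> A\<close> by auto
    then show False using w phi[OF w(1)] finD \<open>a \<notin> D\<close>
      by (cases "a \<in> w") auto
  qed
  then obtain k where k: "k \<in> W" "k \<inter> insert a A = {a}" by blast
  obtain w where w: "w \<in> W" "w \<inter> A = T \<inter> A" using IH[of "T \<inter> A"] by blast
  show ?case
  proof (cases "a \<in> w \<longleftrightarrow> a \<in> T")
    case True
    then have "w \<inter> insert a A = T" using w insert.prems(2) by blast
    then show ?thesis using w by blast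
  next
    case False
    have "sym_diff w k \<inter> insert a A = sym_diff (w \<inter> insert a A) (k \<inter> insert a A)" by blast
    also have "\<dots> = sym_diff (w \<inter> insert a A) {a}" using k by simp
    also have "\<dots> = T" using False w(2) insert.prems(2) \<open>a \<notin> A\<close> by blast
    finally show ?thesis using closed[OF w(1) k(1)] by (rule bexI)
  qed
qed

lemma minimal_local_set_below:
  assumes "finite L" "local_set G L"
  shows "\<exists>M\<subseteq>L. minimal_local_set G M"
proof -
  let ?F = "{M. M \<subseteq> L \<and> local_set G M}"
  have "finite ?F" "?F \<noteq> {}" using assms by auto
  then obtain M where M: "M \<subseteq> L" "local_set G M" "\<forall>N\<in>?F. N \<subseteq> M \<longrightarrow> M = N"
    using finite_has_minimal[of ?F] by blast
  have "N = M" if "local_set G N" "N \<subseteq> M" for N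
  proof -
    have "N \<in> ?F" using M(1) that by auto
    with M(3) that(2) have "M = N" by (metis (lifting))
    then show ?thesis ..
  qed
  with M(1,2) show ?thesis unfolding minimal_local_set_def by blast
qed

context graph
begin

lemma finite_nbhd: "finite (nbhd G v)"
  by (simp add: nbhd_def)

lemma nbhd_sym: "w \<in> nbhd G v \<longleftrightarrow> v \<in> nbhd G w"
  unfolding nbhd_def using sym_arcs adj_in_verts
  by (auto simp: symmetric_def dest: symD)

lemma odd_nbhd_sym_diff:
  "odd_nbhd G (sym_diff D E) = sym_diff (odd_nbhd G D) (odd_nbhd G E)"
proof -
  have "odd (card (nbhd G v \<inter> sym_diff D E)) \<longleftrightarrow>
      odd (card (nbhd G v \<inter> D)) \<noteq> odd (card (nbhd G v \<inter> E))" for v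
  proof -
    have "nbhd G v \<inter> sym_diff D E = sym_diff (nbhd G v \<inter> D) (nbhd G v \<inter> E)" by blast
    then show ?thesis using finite_nbhd by (simp add: odd_card_sym_diff)
  qed
  then show ?thesis unfolding odd_nbhd_def by auto
qed

lemma odd_nbhd_singleton: "odd_nbhd G {w} = nbhd G w"
proof -
  have "nbhd G v \<inter> {w} = (if w \<in> nbhd G v then {w} else {})" for v by auto
  then show ?thesis
    unfolding odd_nbhd_def using nbhd_sym by (auto simp: nbhd_def)
qed

text \<open>Double counting: both cardinalities have the parity of the number of adjacent pairs in
  \<open>D\<close> \<times> \<open>E\<close>.\<close>

lemma odd_nbhd_adjoint:
  assumes "D \<subseteq> verts G" "E \<subseteq> verts G"
  shows "odd (card (D \<inter> odd_nbhd G E)) \<longleftrightarrow> odd (card (E \<inter> odd_nbhd G D))"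
proof -
  have fin: "finite D" "finite E" using assms by (auto intro: finite_subset)
  have par: "even (card (D \<inter> odd_nbhd G E)) \<longleftrightarrow>
      even (\<Sum>x\<in>D. \<Sum>y\<in>E. if y \<in> nbhd G x then 1 else 0 :: nat)"
    if "D \<subseteq> verts G" "finite D" "finite E" for D E
  proof -
    have "D \<inter> odd_nbhd G E = {x \<in> D. odd (card (nbhd G x \<inter> E))}"
      using that by (auto simp: odd_nbhd_def)
    moreover have "(\<Sum>y\<in>E. if y \<in> nbhd G x then 1 else 0) = card (nbhd G x \<inter> E)" for x
      using that by (simp add: sum.If_cases Int_commute)
    ultimately show ?thesis using that by (simp add: even_sum_iff)
  qed
  have "(\<Sum>x\<in>D. \<Sum>y\<in>E. if y \<in> nbhd G x then 1 else 0 :: nat) =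
      (\<Sum>y\<in>E. \<Sum>x\<in>D. if x \<in> nbhd G y then 1 else 0)"
    by (subst sum.swap) (simp add: nbhd_sym)
  then show ?thesis using par[of D E] par[of E D] assms fin by simp
qed

text \<open>The condition defining the set says that the entries of \<open>D\<close> and \<open>E\<close> at \<open>v\<close> are not
  orthogonal.\<close>

lemma even_card_non_orthogonal:
  assumes "D \<subseteq> verts G" "E \<subseteq> verts G"
  shows "even (card {v \<in> verts G. (v \<in> D \<and> v \<in> odd_nbhd G E) \<noteq> (v \<in> E \<and> v \<in> odd_nbhd G D)})"
proof -
  have "{v \<in> verts G. (v \<in> D \<and> v \<in> odd_nbhd G E) \<noteq> (v \<in> E \<and> v \<in> odd_nbhd G D)}
      = sym_diff (D \<inter> odd_nbhd G E) (E \<inter> odd_nbhd G D)"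
    using assms by auto
  moreover have "finite D" "finite E" using assms by (auto intro: finite_subset)
  ultimately show ?thesis
    using odd_card_sym_diff[of "D \<inter> odd_nbhd G E" "E \<inter> odd_nbhd G D"] odd_nbhd_adjoint[OF assms]
    by simp
qed

text \<open>Non-orthogonality at a vertex puts that vertex in both supports, so it can occur only at
  \<open>v\<close>; the number of such vertices is even, hence 0.\<close>

lemma orthogonal_if_common_support_singleton:
  assumes "D \<subseteq> verts G" "E \<subseteq> verts G" "(D \<union> odd_nbhd G D) \<inter> (E \<union> odd_nbhd G E) \<subseteq> {v}"
  shows "(v \<in> D \<and> v \<in> odd_nbhd G E) \<longleftrightarrow> (v \<in> E \<and> v \<in> odd_nbhd G D)"
proof (rule ccontr)
  assume "\<not> ?thesis"
  then have "{v \<in> verts G. (v \<in> D \<and> v \<in> odd_nbhd G E) \<noteq> (v \<in> E \<and> v \<in> odd_nbhd G D)} = {v}"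
    using assms by blast
  then show False using even_card_non_orthogonal[OF assms(1,2)] by simp
qed

text \<open>Duality applied to the odd neighborhoods of sets outside \<open>A\<close>. A non-empty
  \<open>D\<close> inside \<open>A\<close> spans a local set that leaves \<open>A\<close> at some
  \<open>w\<close> in \<open>odd_nbhd G D\<close>, and the neighborhood of this \<open>w\<close>
  meets \<open>D\<close> oddly.\<close>

lemma odd_nbhd_realises_subsets:
  assumes A: "A \<subseteq> verts G" "\<And>L. L \<subseteq> A \<Longrightarrow> \<not> local_set G L" and "T \<subseteq> A"
  shows "\<exists>D \<subseteq> verts G - A. odd_nbhd G D \<inter> A = T"
proof -
  let ?W = "odd_nbhd G ` Pow (verts G - A)"
  have "\<exists>w\<in>?W. w \<inter> A = T"
  proof (rule sym_diff_closed_realises_subsets)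
    show "finite A" using A(1) by (rule finite_subset) simp
    show "{} \<in> ?W" by (rule image_eqI[of _ _ "{}"]) (auto simp: odd_nbhd_def)
    show "sym_diff w w' \<in> ?W" if ww': "w \<in> ?W" "w' \<in> ?W" for w w'
    proof -
      obtain D D' where "D \<subseteq> verts G - A" "D' \<subseteq> verts G - A" "w = odd_nbhd G D" "w' = odd_nbhd G D'"
        using ww' by blast
      then have "sym_diff w w' = odd_nbhd G (sym_diff D D')" "sym_diff D D' \<in> Pow (verts G - A)"
        by (simp only: odd_nbhd_sym_diff, blast)
      then show ?thesis by (rule image_eqI)
    qed
    show "\<exists>w\<in>?W. odd (card (w \<inter> D))" if D: "D \<subseteq> A" "D \<noteq> {}" for D
    proof -
      have "local_set G (D \<union> odd_nbhd G D)" using D A(1) unfolding local_set_def by blast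
      then obtain w where "w \<in> odd_nbhd G D" "w \<notin> A"
        using A(2)[of "D \<union> odd_nbhd G D"] D(1) by blast
      then have "{w} \<in> Pow (verts G - A)" "odd (card (odd_nbhd G {w} \<inter> D))"
        unfolding odd_nbhd_singleton by (auto simp: odd_nbhd_def)
      then show ?thesis by blast
    qed
  qed fact
  then show ?thesis by blast
qed

lemma ex_minimal_local_set_containing:
  assumes u: "u \<in> verts G"
  shows "\<exists>L. minimal_local_set G L \<and> u \<in> L"
proof (rule ccontr)
  assume uncovered: "\<not> ?thesis"
  let ?O = "odd_nbhd G"
  define F where "F = {A. A \<subseteq> verts G - {u} \<and> (\<forall>L\<subseteq>A. \<not> local_set G L)}"
  have "finite F" by (simp add: F_def)
  moreover have "{} \<in> F" by (simp add: F_def local_set_def)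
  ultimately obtain A where "A \<in> F" and max: "\<And>B. B \<in> F \<Longrightarrow> A \<subseteq> B \<Longrightarrow> A = B"
    using finite_has_maximal[of F] by blast
  then have AF: "A \<subseteq> verts G - {u}" "\<And>L. L \<subseteq> A \<Longrightarrow> \<not> local_set G L"
    by (auto simp: F_def)
  let ?A' = "insert u A"
  have A'V: "?A' \<subseteq> verts G" using AF(1) u by auto
  \<comment> \<open>A local set in \<open>?A'\<close> would contain a minimal one, which avoids
    \<open>u\<close> by \<open>uncovered\<close> and hence lies in \<open>A\<close>.\<close>
  have free: "\<not> local_set G L" if L: "L \<subseteq> ?A'" for L
  proof
    assume "local_set G L"
    moreover have "finite L" using L A'V finite_subset[of L "verts G"] by auto
    ultimately obtain M where "M \<subseteq> L" "minimal_local_set G M"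
      using minimal_local_set_below by blast
    moreover from this have "M \<subseteq> A" using uncovered L by blast
    ultimately show False using AF by (auto simp: minimal_local_set_def)
  qed
  \<comment> \<open>The vector of \<open>D\<close> is (0,1) at \<open>u\<close> and zero on
    \<open>A\<close>.\<close>
  obtain D where D: "D \<subseteq> verts G - ?A'" "?O D \<inter> ?A' = {u}"
    using odd_nbhd_realises_subsets[OF A'V free, of "{u}"] by auto
  then have DV: "D \<subseteq> verts G" by blast
  \<comment> \<open>\<open>C'\<close> cancels the odd neighborhood of \<open>{u}\<close> on
    \<open>?A'\<close>, so that the vector of \<open>C\<close> is (1,0) at \<open>u\<close> and zero
    on \<open>A\<close>.\<close>
  obtain C' where C': "C' \<subseteq> verts G - ?A'" "?O C' \<inter> ?A' = ?O {u} \<inter> ?A'"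
    using odd_nbhd_realises_subsets[OF A'V free, of "?O {u} \<inter> ?A'"] by auto
  define C where "C = sym_diff {u} C'"
  have C: "C \<subseteq> verts G" "C \<inter> ?A' = {u}" using C' u AF(1) by (auto simp: C_def)
  have OC: "?O C \<inter> ?A' = {}"
    unfolding C_def odd_nbhd_sym_diff using C' by blast
  have suppC: "(C \<union> ?O C) \<inter> ?A' \<subseteq> {u}" and suppD: "(D \<union> ?O D) \<inter> ?A' \<subseteq> {u}"
    using C(2) OC D by blast+
  have orth: "(v \<in> C \<and> v \<in> ?O D) \<longleftrightarrow> (v \<in> D \<and> v \<in> ?O C)" if v: "v \<in> verts G" "v \<notin> ?A'" for v
  proof -
    \<comment> \<open>Maximality of \<open>A\<close> yields a local set whose only vertex outside
      \<open>A\<close> is \<open>v\<close>; its support meets those of \<open>C\<close> and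
      \<open>D\<close> at most in \<open>v\<close>.\<close>
    have "insert v A \<notin> F" using max v by blast
    moreover have "insert v A \<subseteq> verts G - {u}" using AF(1) v by auto
    ultimately obtain L where L: "L \<subseteq> insert v A" "local_set G L" unfolding F_def by blast
    then have "v \<in> L" using AF(2)[of L] by blast
    obtain E where E: "E \<subseteq> verts G" "L = E \<union> ?O E" using L by (auto simp: local_set_def)
    have "u \<notin> L" using L(1) v AF(1) by auto
    have supp: "(C \<union> ?O C) \<inter> (E \<union> ?O E) \<subseteq> {v}" "(D \<union> ?O D) \<inter> (E \<union> ?O E) \<subseteq> {v}"
      unfolding E(2)[symmetric] using L(1) \<open>u \<notin> L\<close> suppC suppD by blast+
    have "(v \<in> C \<and> v \<in> ?O E) \<longleftrightarrow> (v \<in> E \<and> v \<in> ?O C)"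
      "(v \<in> D \<and> v \<in> ?O E) \<longleftrightarrow> (v \<in> E \<and> v \<in> ?O D)"
      using orthogonal_if_common_support_singleton[OF C(1) E(1) supp(1)]
        orthogonal_if_common_support_singleton[OF DV E(1) supp(2)] .
    \<comment> \<open>The entry of \<open>E\<close> at \<open>v\<close> is non-zero, and in the
      symplectic plane over F_2 only 0 and that entry itself are orthogonal to it; so the entries of
      \<open>C\<close> and \<open>D\<close> are orthogonal to each other.\<close>
    then show ?thesis using \<open>v \<in> L\<close> E(2) by blast
  qed
  have "{v \<in> verts G. (v \<in> C \<and> v \<in> ?O D) \<noteq> (v \<in> D \<and> v \<in> ?O C)} = {u}"
  proof
    show "{v \<in> verts G. (v \<in> C \<and> v \<in> ?O D) \<noteq> (v \<in> D \<and> v \<in> ?O C)} \<subseteq> {u}"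
      using orth C OC D by blast
    show "{u} \<subseteq> {v \<in> verts G. (v \<in> C \<and> v \<in> ?O D) \<noteq> (v \<in> D \<and> v \<in> ?O C)}"
      using u C OC D by blast
  qed
  then show False using even_card_non_orthogonal[OF C(1) DV] by simp
qed

end

theorem theorem1:
  fixes G :: "('a, 'b) pre_digraph"
  assumes "graph G"
  shows "(\<exists>\<L>. mls_cover G \<L>) \<and> (\<forall>u \<in> verts G. \<exists>L. minimal_local_set G L \<and> u \<in> L)"
proof -
  interpret graph G by fact
  have "mls_cover G {L. minimal_local_set G L}"
    using ex_minimal_local_set_containing
    by (auto simp: mls_cover_def minimal_local_set_def local_set_def odd_nbhd_def)
  then show ?thesis using ex_minimal_local_set_containing by blast
qed

end
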